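(* Let $n,k$ be integers with $1<k<n$ and $k>\frac14 n$. Then there exists a $k$-homogeneous partial latin square of order $n$ which is not completable.
   Context: A $k$-homogeneous partial latin square of order $n$ is an $n\times n$ array in which each cell is either blank or contains one of the symbols $\{1,2,\dots,n\}$, such that (i) no symbol occurs twice in any row or any column, (ii) each symbol occurs exactly $k$ times in the array, and (iii) each row and each column contains exactly $k$ filled cells. It is completable if its blank cells can be filled with symbols from $\{1,\dots,n\}$ so as to produce a latin square of order $n$ (an $n\times n$ array in which each symbol occurs exactly once in each row and each column). *)

theory Defs
  imports Main
begin

definition partial_latin_square :: "nat \<Rightarrow> (nat \<Rightarrow> nat \<Rightarrow> nat option) \<Rightarrow> bool" where
  "partial_latin_square n P \<longleftrightarrow>
     (\<forall>i j. (n \<le> i \<or> n \<le> j) \<longrightarrow> P i j = None) \<and>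
     (\<forall>i j s. P i j = Some s \<longrightarrow> s \<in> {1..n}) \<and>
     (\<forall>i j j' s. P i j = Some s \<and> P i j' = Some s \<longrightarrow> j = j') \<and>
     (\<forall>i i' j s. P i j = Some s \<and> P i' j = Some s \<longrightarrow> i = i')"

definition homogeneous_pls :: "nat \<Rightarrow> nat \<Rightarrow> (nat \<Rightarrow> nat \<Rightarrow> nat option) \<Rightarrow> bool" where
  "homogeneous_pls n k P \<longleftrightarrow>
     partial_latin_square n P \<and>
     (\<forall>s\<in>{1..n}. card {(i, j). i < n \<and> j < n \<and> P i j = Some s} = k) \<and>
     (\<forall>i<n. card {j. j < n \<and> P i j \<noteq> None} = k) \<and>
     (\<forall>j<n. card {i. i < n \<and> P i j \<noteq> None} = k)"

definition latin_square :: "nat \<Rightarrow> (nat \<Rightarrow> nat \<Rightarrow> nat) \<Rightarrow> bool" where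
  "latin_square n L \<longleftrightarrow>
     (\<forall>i<n. \<forall>j<n. L i j \<in> {1..n}) \<and>
     (\<forall>i<n. \<forall>s\<in>{1..n}. \<exists>!j. j < n \<and> L i j = s) \<and>
     (\<forall>j<n. \<forall>s\<in>{1..n}. \<exists>!i. i < n \<and> L i j = s)"

definition completable :: "nat \<Rightarrow> (nat \<Rightarrow> nat \<Rightarrow> nat option) \<Rightarrow> bool" where
  "completable n P \<longleftrightarrow>
     (\<exists>L. latin_square n L \<and> (\<forall>i<n. \<forall>j<n. \<forall>s. P i j = Some s \<longrightarrow> L i j = s))"

end

theory Submission
  imports Defs "HOL-Number_Theory.Cong"
begin

text \<open>For \<open>k \<le> n div 2\<close> place two homogeneous squares, of orders \<open>n div 2\<close> and \<open>n - n div 2\<close> and on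
  disjoint sets of symbols, along the diagonal: if \<open>n < 4 * k\<close>, counting the occurrences of the
  first \<open>n div 2\<close> symbols in the first \<open>n div 2\<close> columns of a completion gives a contradiction.
  For larger \<open>k\<close> some blank cell sees all \<open>n\<close> symbols in its row and column. Develop \<open>k\<close> pairs
  \<open>(x, h x)\<close> modulo \<open>n\<close> into the triples \<open>(t + x, t + h x, t)\<close>; cell \<open>(0, 0)\<close> is blank if \<open>h\<close> has no
  fixed point, and it sees every symbol if the pairs cover all residues. Zigzag choices of \<open>h\<close>
  achieve this except for odd \<open>n = k + 1\<close>, where the square of order \<open>n - 1\<close> is prolonged along
  one of its orbits of triples.\<close>

section \<open>Homogeneous squares as sets of triples\<close>

text \<open>Rows, columns and symbols enter symmetrically, so that one argument about a projection
  \<open>p\<close> can serve all three counts. Symbols start at \<open>0\<close> so that they can be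
  residues modulo \<open>n\<close>.\<close>

definition homogeneous_triples :: "nat \<Rightarrow> nat \<Rightarrow> (nat \<times> nat \<times> nat) set \<Rightarrow> bool" where
  "homogeneous_triples n k T \<longleftrightarrow>
     T \<subseteq> {..<n} \<times> {..<n} \<times> {..<n} \<and>
     (\<forall>i j s s'. (i, j, s) \<in> T \<and> (i, j, s') \<in> T \<longrightarrow> s = s') \<and>
     (\<forall>i j j' s. (i, j, s) \<in> T \<and> (i, j', s) \<in> T \<longrightarrow> j = j') \<and>
     (\<forall>i i' j s. (i, j, s) \<in> T \<and> (i', j, s) \<in> T \<longrightarrow> i = i') \<and>
     (\<forall>v<n. card {t \<in> T. fst t = v} = k) \<and>
     (\<forall>v<n. card {t \<in> T. fst (snd t) = v} = k) \<and>
     (\<forall>v<n. card {t \<in> T. snd (snd t) = v} = k)"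

text \<open>\<open>Suc\<close> moves the residues below \<open>n\<close> to the symbol set
  \<open>{1..n}\<close>.\<close>

definition square_of_triples :: "(nat \<times> nat \<times> nat) set \<Rightarrow> nat \<Rightarrow> nat \<Rightarrow> nat option" where
  "square_of_triples T i j =
     (if \<exists>s. (i, j, s) \<in> T then Some (Suc (THE s. (i, j, s) \<in> T)) else None)"

lemma homogeneous_triplesD:
  assumes "homogeneous_triples n k T"
  shows "(i, j, s) \<in> T \<Longrightarrow> i < n \<and> j < n \<and> s < n"
    and "(i, j, s) \<in> T \<Longrightarrow> (i, j, s') \<in> T \<Longrightarrow> s = s'"
    and "(i, j, s) \<in> T \<Longrightarrow> (i, j', s) \<in> T \<Longrightarrow> j = j'"
    and "(i, j, s) \<in> T \<Longrightarrow> (i', j, s) \<in> T \<Longrightarrow> i = i'"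
    and "v < n \<Longrightarrow> card {t \<in> T. fst t = v} = k"
    and "v < n \<Longrightarrow> card {t \<in> T. fst (snd t) = v} = k"
    and "v < n \<Longrightarrow> card {t \<in> T. snd (snd t) = v} = k"
    and "finite T"
proof -
  note H1 = assms[unfolded homogeneous_triples_def]
  note H2 = H1[THEN conjunct2] note H3 = H2[THEN conjunct2] note H4 = H3[THEN conjunct2]
  show "(i, j, s) \<in> T \<Longrightarrow> i < n \<and> j < n \<and> s < n"
    using H1[THEN conjunct1] by blast
  show "(i, j, s) \<in> T \<Longrightarrow> (i, j, s') \<in> T \<Longrightarrow> s = s'"
    using H2[THEN conjunct1] by blast
  show "(i, j, s) \<in> T \<Longrightarrow> (i, j', s) \<in> T \<Longrightarrow> j = j'"
    using H3[THEN conjunct1] by blast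
  show "(i, j, s) \<in> T \<Longrightarrow> (i', j, s) \<in> T \<Longrightarrow> i = i'"
    using H4[THEN conjunct1] by blast
  show "v < n \<Longrightarrow> card {t \<in> T. fst t = v} = k"
    and "v < n \<Longrightarrow> card {t \<in> T. fst (snd t) = v} = k"
    and "v < n \<Longrightarrow> card {t \<in> T. snd (snd t) = v} = k"
    using H4[THEN conjunct2] by simp_all
  show "finite T"
    using H1[THEN conjunct1] by (rule finite_subset) simp
qed

lemma square_of_triples_eq_Some:
  assumes "homogeneous_triples n k T"
  shows "square_of_triples T i j = Some u \<longleftrightarrow> (\<exists>s. u = Suc s \<and> (i, j, s) \<in> T)"
proof -
  have "(THE s. (i, j, s) \<in> T) = s" if "(i, j, s) \<in> T" for s
    using that homogeneous_triplesD(2)[OF assms] by blast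
  then show ?thesis
    unfolding square_of_triples_def by auto
qed

lemma homogeneous_pls_square_of_triples:
  assumes T: "homogeneous_triples n k T"
  shows "homogeneous_pls n k (square_of_triples T)"
proof -
  note D = homogeneous_triplesD[OF T]
  note S = square_of_triples_eq_Some[OF T]
  have N: "square_of_triples T i j \<noteq> None \<longleftrightarrow> (\<exists>s. (i, j, s) \<in> T)" for i j
    by (simp add: square_of_triples_def)
  have "partial_latin_square n (square_of_triples T)"
    unfolding partial_latin_square_def
  proof (intro conjI allI impI)
    fix i j assume "n \<le> i \<or> n \<le> j"
    then show "square_of_triples T i j = None"
      using D(1) N by (metis leD)
  next
    fix i j s assume "square_of_triples T i j = Some s"
    then show "s \<in> {1..n}" using D(1) S by fastforce
  qed (metis D(3) S nat.inject, metis D(4) S nat.inject)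
  moreover have "card {(i, j). i < n \<and> j < n \<and> square_of_triples T i j = Some u} = k"
    if "u \<in> {1..n}" for u
  proof -
    from that have "u = Suc (u - 1)" "u - 1 < n" by auto
    then obtain s where s: "u = Suc s" "s < n" by blast
    have "bij_betw (\<lambda>t. (fst t, fst (snd t))) {t \<in> T. snd (snd t) = s}
        {(i, j). i < n \<and> j < n \<and> square_of_triples T i j = Some u}"
      unfolding bij_betw_def inj_on_def using D(1) by (force simp: S s image_iff)
    then show ?thesis using D(7)[OF s(2)] bij_betw_same_card by fastforce
  qed
  moreover have "card {j. j < n \<and> square_of_triples T i j \<noteq> None} = k" if "i < n" for i
  proof -
    have "bij_betw (\<lambda>t. fst (snd t)) {t \<in> T. fst t = i} {j. j < n \<and> square_of_triples T i j \<noteq> None}"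
      unfolding bij_betw_def inj_on_def N using D(1,2) by (force simp: image_iff)
    then show ?thesis using D(5)[OF that] bij_betw_same_card by fastforce
  qed
  moreover have "card {i. i < n \<and> square_of_triples T i j \<noteq> None} = k" if "j < n" for j
  proof -
    have "bij_betw fst {t \<in> T. fst (snd t) = j} {i. i < n \<and> square_of_triples T i j \<noteq> None}"
      unfolding bij_betw_def inj_on_def N using D(1,2) by (force simp: image_iff)
    then show ?thesis using D(6)[OF that] bij_betw_same_card by fastforce
  qed
  ultimately show ?thesis
    unfolding homogeneous_pls_def by blast
qed

lemma latin_squareD:
  assumes "latin_square n L"
  shows "i < n \<Longrightarrow> j < n \<Longrightarrow> L i j \<in> {1..n}"
    and "i < n \<Longrightarrow> s \<in> {1..n} \<Longrightarrow> \<exists>!j. j < n \<and> L i j = s"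
    and "j < n \<Longrightarrow> s \<in> {1..n} \<Longrightarrow> \<exists>!i. i < n \<and> L i j = s"
  using assms unfolding latin_square_def by simp_all

lemma latin_square_inj:
  assumes "latin_square n L"
  shows "i < n \<Longrightarrow> j < n \<Longrightarrow> j' < n \<Longrightarrow> L i j = L i j' \<Longrightarrow> j = j'"
    and "i < n \<Longrightarrow> i' < n \<Longrightarrow> j < n \<Longrightarrow> L i j = L i' j \<Longrightarrow> i = i'"
  using latin_squareD[OF assms] by metis+

section \<open>Two obstructions to completion\<close>

definition blocked_cell :: "nat \<Rightarrow> nat \<Rightarrow> nat \<Rightarrow> (nat \<times> nat \<times> nat) set \<Rightarrow> bool" where
  "blocked_cell n i j T \<longleftrightarrow> i < n \<and> j < n \<and> (\<forall>s. (i, j, s) \<notin> T) \<and>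
     (\<forall>s<n. (\<exists>j'. (i, j', s) \<in> T) \<or> (\<exists>i'. (i', j, s) \<in> T))"

text \<open>A completion keeps all given triples, so whatever it puts into the blank cell already
  stands in another cell of that row or column.\<close>

lemma not_completable_if_blocked_cell:
  assumes T: "homogeneous_triples n k T" and B: "blocked_cell n i j T"
  shows "\<not> completable n (square_of_triples T)"
proof
  note D = homogeneous_triplesD[OF T]
  assume "completable n (square_of_triples T)"
  then obtain L where L: "latin_square n L"
    and ext: "\<And>i j s. i < n \<Longrightarrow> j < n \<Longrightarrow> square_of_triples T i j = Some s \<Longrightarrow> L i j = s"
    unfolding completable_def by blast
  have LT: "L i j = Suc s" if "(i, j, s) \<in> T" for i j s
    using ext D(1)[OF that] square_of_triples_eq_Some[OF T] that by blast
  have ij: "i < n" "j < n" and empty: "\<And>s. (i, j, s) \<notin> T"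
    using B unfolding blocked_cell_def by auto
  have "L i j \<in> {1..n}"
    using latin_squareD(1)[OF L] ij .
  then have "L i j = Suc (L i j - 1)" "L i j - 1 < n" by auto
  then obtain s where s: "L i j = Suc s" "s < n" by blast
  have "(\<exists>j'. (i, j', s) \<in> T) \<or> (\<exists>i'. (i', j, s) \<in> T)"
    using B s(2) unfolding blocked_cell_def by simp
  then consider j' where "(i, j', s) \<in> T" | i' where "(i', j, s) \<in> T"
    by (elim disjE exE)
  then show False
  proof cases
    case 1
    have "j' = j" by (rule latin_square_inj(1)[OF L ij(1)]) (use LT[OF 1] D(1)[OF 1] s ij in auto)
    then show False using 1 empty by blast
  next
    case 2
    have "i' = i" by (rule latin_square_inj(2)[OF L _ _ ij(2)]) (use LT[OF 2] D(1)[OF 2] s ij in auto)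
    then show False using 2 empty by blast
  qed
qed

text \<open>Double counting of the symbols up to \<open>a\<close> in the first \<open>a\<close> columns of a completion:
  there are \<open>a\<^sup>2\<close> of them; each of the first \<open>a\<close> rows contributes at least \<open>k\<close>, and each of the
  other rows at least \<open>2 * a - n + k\<close>, because at least \<open>k\<close> of its last \<open>n - a\<close> cells hold
  symbols above \<open>a\<close>.\<close>

lemma not_completable_if_block_diagonal:
  assumes T: "homogeneous_triples n k T" and "a \<le> n"
    and block: "\<And>i j s. (i, j, s) \<in> T \<Longrightarrow> (i < a \<longleftrightarrow> j < a) \<and> (i < a \<longleftrightarrow> s < a)"
    and large: "int a * int a < int n * int k + (int n - int a) * (2 * int a - int n)"
  shows "\<not> completable n (square_of_triples T)"
proof
  note D = homogeneous_triplesD[OF T]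
  assume "completable n (square_of_triples T)"
  then obtain L where L: "latin_square n L"
    and ext: "\<And>i j s. i < n \<Longrightarrow> j < n \<Longrightarrow> square_of_triples T i j = Some s \<Longrightarrow> L i j = s"
    unfolding completable_def by blast
  have LT: "L i j = Suc s" if "(i, j, s) \<in> T" for i j s
    using ext D(1)[OF that] square_of_triples_eq_Some[OF T] that by blast
  \<comment> \<open>A triple with \<open>s < a\<close> carries the symbol \<open>Suc s\<close>,
    hence the bound \<open>\<le> a\<close>.\<close>
  define low where "low i J = {j \<in> J. L i j \<le> a}" for i and J :: "nat set"
  have row_card: "card (low i {..<n}) = a" if "i < n" for i
  proof -
    have "bij_betw (L i) (low i {..<n}) {1..a}"
      unfolding bij_betw_def
    proof
      show "inj_on (L i) (low i {..<n})"
        using latin_square_inj(1)[OF L \<open>i < n\<close>] by (auto simp: inj_on_def low_def)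
      have "s \<in> L i ` low i {..<n}" if "s \<in> {1..a}" for s
      proof -
        have "s \<in> {1..n}" using that \<open>a \<le> n\<close> by auto
        then obtain j where "j < n" "L i j = s"
          using latin_squareD(2)[OF L \<open>i < n\<close>] by blast
        then show ?thesis using that by (auto simp: low_def)
      qed
      moreover have "1 \<le> L i j" if "j < n" for j
        using latin_squareD(1)[OF L \<open>i < n\<close> that] by simp
      ultimately show "L i ` low i {..<n} = {1..a}"
        by (auto simp: low_def)
    qed
    then show ?thesis using bij_betw_same_card by fastforce
  qed
  have col_card: "card {i \<in> {..<n}. L i j \<le> a} = a" if "j < n" for j
  proof -
    have "bij_betw (\<lambda>i. L i j) {i \<in> {..<n}. L i j \<le> a} {1..a}"
      unfolding bij_betw_def
    proof
      show "inj_on (\<lambda>i. L i j) {i \<in> {..<n}. L i j \<le> a}"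
        using latin_square_inj(2)[OF L _ _ \<open>j < n\<close>] by (auto simp: inj_on_def)
      have "s \<in> (\<lambda>i. L i j) ` {i \<in> {..<n}. L i j \<le> a}" if "s \<in> {1..a}" for s
      proof -
        have "s \<in> {1..n}" using that \<open>a \<le> n\<close> by auto
        then obtain i where "i < n" "L i j = s"
          using latin_squareD(3)[OF L \<open>j < n\<close>] by blast
        then show ?thesis using that by auto
      qed
      moreover have "1 \<le> L i j" if "i < n" for i
        using latin_squareD(1)[OF L that \<open>j < n\<close>] by simp
      ultimately show "(\<lambda>i. L i j) ` {i \<in> {..<n}. L i j \<le> a} = {1..a}"
        by auto
    qed
    then show ?thesis using bij_betw_same_card by fastforce
  qed
  have cols_T: "card ((\<lambda>t. fst (snd t)) ` {t \<in> T. fst t = i}) = k" if "i < n" for i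
  proof -
    have "inj_on (\<lambda>t. fst (snd t)) {t \<in> T. fst t = i}"
      unfolding inj_on_def using D(2) by fastforce
    then show ?thesis using D(5)[OF that] by (simp add: card_image)
  qed
  have top: "int k \<le> int (card (low i {..<a}))" if "i < a" for i
  proof -
    have "(\<lambda>t. fst (snd t)) ` {t \<in> T. fst t = i} \<subseteq> low i {..<a}"
      using block LT that by (fastforce simp: low_def)
    moreover have "finite (low i {..<a})" by (simp add: low_def)
    ultimately have "card ((\<lambda>t. fst (snd t)) ` {t \<in> T. fst t = i}) \<le> card (low i {..<a})"
      by (intro card_mono)
    then show ?thesis using cols_T[of i] that \<open>a \<le> n\<close> by simp
  qed
  \<comment> \<open>The estimate is stated over \<open>int\<close> because \<open>2 * a - n\<close>
    is \<open>-1\<close> when \<open>n\<close> is odd and \<open>a = n div 2\<close>.\<close>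
  have bot: "2 * int a - int n + int k \<le> int (card (low i {..<a}))" if "a \<le> i" "i < n" for i
  proof -
    let ?H = "{j \<in> {a..<n}. \<not> L i j \<le> a}"
    have "(\<lambda>t. fst (snd t)) ` {t \<in> T. fst t = i} \<subseteq> ?H"
      using block LT that D(1) by (fastforce simp: not_le)
    then have "card ((\<lambda>t. fst (snd t)) ` {t \<in> T. fst t = i}) \<le> card ?H"
      by (intro card_mono) auto
    then have "k \<le> card ?H" using cols_T[OF that(2)] by simp
    moreover have "card ?H + card (low i {a..<n}) = n - a"
    proof -
      have "?H \<union> low i {a..<n} = {a..<n}" by (auto simp: low_def)
      moreover have "card (?H \<union> low i {a..<n}) = card ?H + card (low i {a..<n})"
        by (rule card_Un_disjoint) (auto simp: low_def)
      ultimately show ?thesis by simp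
    qed
    moreover have "card (low i {..<a}) + card (low i {a..<n}) = a"
    proof -
      have "low i {..<a} \<union> low i {a..<n} = low i {..<n}" using \<open>a \<le> n\<close> by (auto simp: low_def)
      moreover have "card (low i {..<a} \<union> low i {a..<n}) = card (low i {..<a}) + card (low i {a..<n})"
        by (rule card_Un_disjoint) (auto simp: low_def)
      ultimately show ?thesis using row_card[OF that(2)] by simp
    qed
    ultimately show ?thesis using \<open>a \<le> n\<close> by linarith
  qed
  have "(\<Sum>i<n. card (low i {..<a})) = (\<Sum>j<a. card {i \<in> {..<n}. L i j \<le> a})"
    using sum_multicount_gen[of "{..<n}" "{..<a}" "\<lambda>i j. L i j \<le> a" "\<lambda>j. card {i \<in> {..<n}. L i j \<le> a}"]
    by (simp add: low_def)
  also have "\<dots> = a * a"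
    using col_card \<open>a \<le> n\<close> by simp
  finally have "int a * int a = (\<Sum>i<n. int (card (low i {..<a})))"
    by (metis of_nat_mult of_nat_sum)
  also have "\<dots> = (\<Sum>i<a. int (card (low i {..<a}))) + (\<Sum>i\<in>{a..<n}. int (card (low i {..<a})))"
    using \<open>a \<le> n\<close> by (simp add: lessThan_atLeast0 sum.atLeastLessThan_concat)
  also have "\<dots> \<ge> (\<Sum>i<a. int k) + (\<Sum>i\<in>{a..<n}. 2 * int a - int n + int k)"
    by (intro add_mono sum_mono) (use top bot in auto)
  finally have "int a * int k + (int n - int a) * (2 * int a - int n + int k) \<le> int a * int a"
    using \<open>a \<le> n\<close> by (simp add: of_nat_diff)
  then show False using large by (simp add: algebra_simps)
qed

section \<open>Direct sums\<close>

definition direct_sum :: "nat \<Rightarrow> (nat \<times> nat \<times> nat) set \<Rightarrow> (nat \<times> nat \<times> nat) set \<Rightarrow> (nat \<times> nat \<times> nat) set" where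
  "direct_sum a T U = T \<union> (\<lambda>(i, j, s). (a + i, a + j, a + s)) ` U"

lemma homogeneous_triples_direct_sum:
  assumes T: "homogeneous_triples a k T" and U: "homogeneous_triples b k U"
  shows "homogeneous_triples (a + b) k (direct_sum a T U)"
proof -
  note DT = homogeneous_triplesD[OF T] and DU = homogeneous_triplesD[OF U]
  let ?f = "\<lambda>(i, j, s). (a + i, a + j, a + s)"
  have mem: "(i, j, s) \<in> direct_sum a T U \<longleftrightarrow>
      (i, j, s) \<in> T \<or> a \<le> i \<and> a \<le> j \<and> a \<le> s \<and> (i - a, j - a, s - a) \<in> U" for i j s
    unfolding direct_sum_def by (force simp: image_iff)
  have inj: "inj_on ?f A" for A by (auto simp: inj_on_def)
  \<comment> \<open>Here \<open>p\<close> is any of the three projections. A fibre over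
    \<open>v < a\<close> lies in \<open>T\<close>, any other fibre in the shifted copy of
    \<open>U\<close>.\<close>
  have card: "card {t \<in> direct_sum a T U. p t = v} = k"
    if "v < a + b" and pT: "\<And>t. t \<in> T \<Longrightarrow> p t < a" and pU: "\<And>i j s. p (a + i, a + j, a + s) = a + p (i, j, s)"
      and cT: "\<And>v. v < a \<Longrightarrow> card {t \<in> T. p t = v} = k"
      and cU: "\<And>v. v < b \<Longrightarrow> card {t \<in> U. p t = v} = k"
    for v and p :: "nat \<times> nat \<times> nat \<Rightarrow> nat"
  proof (cases "v < a")
    case True
    then have "{t \<in> direct_sum a T U. p t = v} = {t \<in> T. p t = v}"
      by (auto simp: direct_sum_def pU)
    then show ?thesis using cT True by simp
  next
    case False
    then have "t \<notin> T" if "p t = v" for t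
      using pT[of t] that by auto
    then have "{t \<in> direct_sum a T U. p t = v} = {t \<in> ?f ` U. p t = v}"
      unfolding direct_sum_def by blast
    also have "\<dots> = ?f ` {t \<in> U. p (?f t) = v}"
      by blast
    also have "\<dots> = ?f ` {t \<in> U. p t = v - a}"
    proof -
      have "p (?f t) = v \<longleftrightarrow> p t = v - a" for t
        using False by (cases t) (auto simp: pU)
      then show ?thesis by simp
    qed
    finally have "{t \<in> direct_sum a T U. p t = v} = ?f ` {t \<in> U. p t = v - a}" .
    then show ?thesis using cU[of "v - a"] False that(1) by (simp add: card_image inj)
  qed
  show ?thesis
    unfolding homogeneous_triples_def
  proof (intro conjI allI impI)
    show "direct_sum a T U \<subseteq> {..<a + b} \<times> {..<a + b} \<times> {..<a + b}"
      using DT(1) DU(1) unfolding direct_sum_def by fastforce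
  next
    fix i j s s' assume "(i, j, s) \<in> direct_sum a T U \<and> (i, j, s') \<in> direct_sum a T U"
    then show "s = s'" unfolding mem using DT(1,2) DU(2) by (metis eq_diff_iff leD)
  next
    fix i j j' s assume "(i, j, s) \<in> direct_sum a T U \<and> (i, j', s) \<in> direct_sum a T U"
    then show "j = j'" unfolding mem using DT(1,3) DU(3) by (metis eq_diff_iff leD)
  next
    fix i i' j s assume "(i, j, s) \<in> direct_sum a T U \<and> (i', j, s) \<in> direct_sum a T U"
    then show "i = i'" unfolding mem using DT(1,4) DU(4) by (metis eq_diff_iff leD)
  qed (rule card, use DT(1,5-7) DU(5-7) in auto)+
qed

section \<open>Cyclic constructions\<close>

text \<open>Row and column are given relative to the symbol \<open>t\<close>. Each \<open>x\<close>
  thus contributes an orbit of \<open>n\<close> triples that meets every row, column and symbol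
  exactly once.\<close>

definition cyclic_triples :: "nat \<Rightarrow> (nat \<Rightarrow> nat) \<Rightarrow> nat set \<Rightarrow> (nat \<times> nat \<times> nat) set" where
  "cyclic_triples n h X = (\<lambda>(t, x). ((t + x) mod n, (t + h x) mod n, t)) ` ({..<n} \<times> X)"

text \<open>Subtraction free form of the condition that \<open>h\<close> and \<open>\<lambda>x. h x - x\<close> are injective modulo \<open>n\<close>.\<close>

definition partial_orthomorphism :: "nat \<Rightarrow> (nat \<Rightarrow> nat) \<Rightarrow> nat set \<Rightarrow> bool" where
  "partial_orthomorphism n h X \<longleftrightarrow> X \<subseteq> {..<n} \<and> h ` X \<subseteq> {..<n} \<and> inj_on h X \<and>
     (\<forall>x\<in>X. \<forall>y\<in>X. [h x + y = h y + x] (mod n) \<longrightarrow> x = y)"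

lemma ex1_add_mod:
  fixes n c v :: nat
  assumes "v < n"
  shows "\<exists>!t. t < n \<and> (t + c) mod n = v"
proof -
  have "inj_on (\<lambda>t. (t + c) mod n) {..<n}"
    by (auto simp: inj_on_def cong_def[symmetric] cong_add_rcancel_nat) (simp add: cong_def)
  moreover have "(\<lambda>t. (t + c) mod n) ` {..<n} \<subseteq> {..<n}"
    using assms by auto
  ultimately have "(\<lambda>t. (t + c) mod n) ` {..<n} = {..<n}"
    by (simp add: endo_inj_surj)
  then have "v \<in> (\<lambda>t. (t + c) mod n) ` {..<n}" using assms by simp
  then obtain t where t: "t < n" "(t + c) mod n = v" by auto
  moreover have "u = t" if "u < n" "(u + c) mod n = v" for u
    using \<open>inj_on _ _\<close> t that by (auto dest: inj_onD)
  ultimately show ?thesis by blast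
qed

text \<open>For each \<open>x\<close>, translation by \<open>c x\<close> permutes the residues and
  so hits \<open>v\<close> once. The identity, \<open>h\<close> and zero as \<open>c\<close> give
  the row, column and symbol counts of \<open>cyclic_triples\<close>.\<close>

lemma card_add_mod_fibre:
  fixes n v :: nat
  assumes "v < n" "finite X"
  shows "card {p \<in> {..<n} \<times> X. (fst p + c (snd p)) mod n = v} = card X"
proof -
  have "bij_betw snd {p \<in> {..<n} \<times> X. (fst p + c (snd p)) mod n = v} X"
    unfolding bij_betw_def
  proof
    show "inj_on snd {p \<in> {..<n} \<times> X. (fst p + c (snd p)) mod n = v}"
      using ex1_add_mod[OF assms(1)] by (fastforce simp: inj_on_def)
    have "x \<in> snd ` {p \<in> {..<n} \<times> X. (fst p + c (snd p)) mod n = v}" if "x \<in> X" for x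
    proof -
      obtain t where "t < n" "(t + c x) mod n = v" using ex1_add_mod[OF assms(1)] by blast
      then show ?thesis using that by (intro image_eqI[of _ _ "(t, x)"]) auto
    qed
    then show "snd ` {p \<in> {..<n} \<times> X. (fst p + c (snd p)) mod n = v} = X" by auto
  qed
  then show ?thesis by (rule bij_betw_same_card)
qed

text \<open>Symbol and row determine \<open>x\<close>, hence the column; symbol and column determine
  \<open>x\<close> since \<open>h\<close> is injective; a cell determines \<open>h x - x\<close>,
  hence \<open>x\<close> and then the symbol.\<close>

lemma homogeneous_triples_cyclic:
  assumes "partial_orthomorphism n h X"
  shows "homogeneous_triples n (card X) (cyclic_triples n h X)"
proof -
  have X: "X \<subseteq> {..<n}" and hX: "h ` X \<subseteq> {..<n}" and inj: "inj_on h X"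
    and ortho: "\<And>x y. x \<in> X \<Longrightarrow> y \<in> X \<Longrightarrow> [h x + y = h y + x] (mod n) \<Longrightarrow> x = y"
    using assms unfolding partial_orthomorphism_def by auto
  have fin: "finite X" using X finite_subset by blast
  let ?F = "\<lambda>(t, x). ((t + x) mod n, (t + h x) mod n, t)"
  have cancel: "x = y" if "(t + x) mod n = (t + y) mod n" "x < n" "y < n" for t x y
    using that by (metis cong_add_lcancel_nat cong_def mod_less)
  have mem: "(i, j, s) \<in> cyclic_triples n h X \<longleftrightarrow>
      (\<exists>x\<in>X. s < n \<and> i = (s + x) mod n \<and> j = (s + h x) mod n)" for i j s
    unfolding cyclic_triples_def by (auto simp: image_iff)
  have injF: "inj_on ?F ({..<n} \<times> X)"
    using X by (auto simp: inj_on_def intro: cancel)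
  have card: "card {t \<in> cyclic_triples n h X. p t = v} = card X"
    if "v < n" and "\<And>q. q \<in> {..<n} \<times> X \<Longrightarrow> p (?F q) = (fst q + c (snd q)) mod n" for p c v
  proof -
    have "{t \<in> cyclic_triples n h X. p t = v} =
        ?F ` {q \<in> {..<n} \<times> X. (fst q + c (snd q)) mod n = v}"
      unfolding cyclic_triples_def using that(2) by auto
    moreover have "card \<dots> = card {q \<in> {..<n} \<times> X. (fst q + c (snd q)) mod n = v}"
      by (rule card_image) (rule inj_on_subset[OF injF], auto)
    ultimately show ?thesis using card_add_mod_fibre[OF that(1) fin, of c] by simp
  qed
  show ?thesis
    unfolding homogeneous_triples_def
  proof (intro conjI allI impI)
    show "cyclic_triples n h X \<subseteq> {..<n} \<times> {..<n} \<times> {..<n}"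
      unfolding cyclic_triples_def by auto
  next
    fix i j s s' assume "(i, j, s) \<in> cyclic_triples n h X \<and> (i, j, s') \<in> cyclic_triples n h X"
    then obtain x y where xy: "x \<in> X" "y \<in> X" "s < n" "s' < n"
      and r: "[s + x = s' + y] (mod n)" and c: "[s + h x = s' + h y] (mod n)"
      unfolding mem cong_def by metis
    \<comment> \<open>Adding the two congruences crosswise compares the differences
      \<open>h x - x\<close> and \<open>h y - y\<close> without subtraction.\<close>
    have "[(s + h x) + (s' + y) = (s' + h y) + (s + x)] (mod n)"
      using cong_add[OF c cong_sym[OF r]] .
    then have "[(s + s') + (h x + y) = (s + s') + (h y + x)] (mod n)"
      by (simp add: ac_simps)
    then have "x = y" using ortho xy by (simp add: cong_add_lcancel_nat)
    then have "[s = s'] (mod n)" using r by (simp add: cong_add_rcancel_nat)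
    then show "s = s'" using xy by (simp add: cong_def)
  next
    fix i j j' s assume "(i, j, s) \<in> cyclic_triples n h X \<and> (i, j', s) \<in> cyclic_triples n h X"
    then show "j = j'" unfolding mem using cancel X by blast
  next
    fix i i' j s assume "(i, j, s) \<in> cyclic_triples n h X \<and> (i', j, s) \<in> cyclic_triples n h X"
    then obtain x y where "x \<in> X" "y \<in> X" "i = (s + x) mod n" "i' = (s + y) mod n"
      "(s + h x) mod n = (s + h y) mod n"
      unfolding mem by blast
    then show "i = i'" using cancel[of s "h x" "h y"] hX inj by (metis image_subset_iff inj_onD lessThan_iff)
  next
    fix v assume "v < n"
    then show "card {t \<in> cyclic_triples n h X. fst t = v} = card X"
      by (rule card[where c = "\<lambda>x. x"]) auto
    from \<open>v < n\<close> show "card {t \<in> cyclic_triples n h X. fst (snd t) = v} = card X"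
      by (rule card[where c = h]) auto
    from \<open>v < n\<close> show "card {t \<in> cyclic_triples n h X. snd (snd t) = v} = card X"
      by (rule card[where c = "\<lambda>x. 0"]) auto
  qed
qed

lemma blocked_cell_cyclic:
  assumes "partial_orthomorphism n h X" and "0 < n"
    and fix_free: "\<And>x. x \<in> X \<Longrightarrow> h x \<noteq> x"
    and cover: "{..<n} \<subseteq> X \<union> h ` X"
  shows "blocked_cell n 0 0 (cyclic_triples n h X)"
proof -
  have lt: "x < n" "h x < n" if "x \<in> X" for x
    using assms(1) that unfolding partial_orthomorphism_def by auto
  have mem: "(i, j, s) \<in> cyclic_triples n h X \<longleftrightarrow>
      (\<exists>x\<in>X. s < n \<and> i = (s + x) mod n \<and> j = (s + h x) mod n)" for i j s
    unfolding cyclic_triples_def by (auto simp: image_iff)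
  have "(0, 0, s) \<notin> cyclic_triples n h X" for s
  proof
    assume "(0, 0, s) \<in> cyclic_triples n h X"
    then obtain x where "x \<in> X" "(s + x) mod n = (s + h x) mod n"
      unfolding mem by metis
    then show False using fix_free lt by (metis cong_add_lcancel_nat cong_def mod_less)
  qed
  moreover have "(\<exists>j. (0, j, s) \<in> cyclic_triples n h X) \<or> (\<exists>i. (i, 0, s) \<in> cyclic_triples n h X)"
    if "s < n" for s
  proof -
    obtain y where y': "y < n \<and> (y + s) mod n = 0"
      using ex1_implies_ex[OF ex1_add_mod[OF assms(2), of s]] by (rule exE)
    have y: "y < n" "(s + y) mod n = 0"
      using y' by (simp_all only: add.commute[of s y])
    have "y \<in> X \<union> h ` X" using subsetD[OF cover, of y] y(1) by simp
    then consider "y \<in> X" | x where "x \<in> X" "y = h x" by blast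
    then show ?thesis
    proof cases
      case 1
      then have "(0, (s + h y) mod n, s) \<in> cyclic_triples n h X"
        unfolding mem using y(2) that by (intro bexI[of _ y]) simp_all
      then show ?thesis by blast
    next
      case 2
      then have "((s + x) mod n, 0, s) \<in> cyclic_triples n h X"
        unfolding mem using y(2) that by (intro bexI[of _ x]) simp_all
      then show ?thesis by blast
    qed
  qed
  ultimately show ?thesis unfolding blocked_cell_def using assms(2) by simp
qed

section \<open>Explicit partial orthomorphisms\<close>

text \<open>Lets a single \<open>h\<close> serve many degrees \<open>k\<close>, by restriction to
  \<open>{..<k}\<close>.\<close>

lemma partial_orthomorphism_mono:
  "partial_orthomorphism n h X \<Longrightarrow> Y \<subseteq> X \<Longrightarrow> partial_orthomorphism n h Y"
  unfolding partial_orthomorphism_def by (auto intro: inj_on_subset) (meson subsetD)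

text \<open>The differences \<open>h x - x\<close> are the odd residues for \<open>x < m\<close> and the nonzero even residues
  for \<open>m \<le> x\<close>.\<close>

definition even_zigzag :: "nat \<Rightarrow> nat \<Rightarrow> nat" where
  "even_zigzag m x = (if x < m then 2 * m - 1 - x else 2 * m - 2 - x)"

text \<open>The difference is a multiple of \<open>n\<close> strictly between \<open>- 2 * n\<close>
  and \<open>2 * n\<close>. Sums of two residues satisfy the bounds, so congruences between them
  become linear case distinctions.\<close>

lemma cong_nat_cases:
  fixes a b n :: nat
  assumes "[a = b] (mod n)" "a < b + 2 * n" "b < a + 2 * n"
  shows "a = b \<or> a = b + n \<or> b = a + n"
proof -
  have "int n dvd int a - int b"
    using assms(1) by (simp add: cong_iff_dvd_diff flip: cong_int_iff)
  then obtain q where q: "int a - int b = int n * q" by (rule dvdE)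
  have "q < 2"
  proof (rule ccontr)
    assume "\<not> q < 2"
    then have "int n * 2 \<le> int n * q" by (intro mult_left_mono) auto
    then show False using q assms(2) by linarith
  qed
  moreover have "- 2 < q"
  proof (rule ccontr)
    assume "\<not> - 2 < q"
    then have "int n * q \<le> int n * (- 2)" by (intro mult_left_mono) auto
    then show False using q assms(3) by linarith
  qed
  ultimately consider "q = 0" | "q = 1" | "q = - 1" by linarith
  then show ?thesis
    using q by cases auto
qed

text \<open>One residue has to be left out, because a cyclic group of even order has no
  orthomorphism defined on all of it.\<close>

lemma partial_orthomorphism_even_zigzag:
  "partial_orthomorphism (2 * m) (even_zigzag m) {..<2 * m - 1}"
  unfolding partial_orthomorphism_def
proof (intro conjI ballI impI)
  show "inj_on (even_zigzag m) {..<2 * m - 1}"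
    unfolding inj_on_def even_zigzag_def by auto
next
  fix x y assume "x \<in> {..<2 * m - 1}" "y \<in> {..<2 * m - 1}"
    and c: "[even_zigzag m x + y = even_zigzag m y + x] (mod 2 * m)"
  then have x: "x < 2 * m - 1" and y: "y < 2 * m - 1" by auto
  \<comment> \<open>With \<open>h x = 2 * m - x - d x\<close> the congruence becomes
    \<open>2 * y + d y = 2 * x + d x\<close> modulo \<open>2 * m\<close>. Its parity puts
    \<open>x\<close> and \<open>y\<close> into the same half, and a half is too short for two points
    at distance \<open>m\<close>.\<close>
  define d :: "nat \<Rightarrow> nat" where "d z = (if z < m then 1 else 2)" for z
  have e: "even_zigzag m z + z + d z = 2 * m" if "z < 2 * m - 1" for z
    using that by (auto simp: even_zigzag_def d_def)
  have "even_zigzag m x + y = even_zigzag m y + x \<or>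
      even_zigzag m x + y = even_zigzag m y + x + 2 * m \<or>
      even_zigzag m y + x = even_zigzag m x + y + 2 * m"
    using c e[OF x] e[OF y] x y by (intro cong_nat_cases) auto
  then have E: "2 * y + d y = 2 * x + d x \<or> 2 * y + d y = 2 * x + d x + 2 * m \<or>
      2 * x + d x = 2 * y + d y + 2 * m"
    using e[OF x] e[OF y] by linarith
  then have "even (d y) = even (d x)"
    by (elim disjE) (drule arg_cong[of _ _ even], simp)+
  then have "x < m \<longleftrightarrow> y < m" by (auto simp: d_def split: if_splits)
  then show "x = y"
    using E x y unfolding d_def by (elim disjE) (auto split: if_splits)
qed (auto simp: even_zigzag_def)

text \<open>The differences \<open>h x - x\<close> are \<open>2\<close>, then the odd residues for \<open>1 \<le> x \<le> m\<close>, then the even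
  residues from \<open>2 * m\<close> down to \<open>6\<close>. The exceptional value at \<open>0\<close> moves the fixed point of
  \<open>x \<mapsto> - x\<close>.\<close>

definition odd_zigzag :: "nat \<Rightarrow> nat \<Rightarrow> nat" where
  "odd_zigzag m x = (if x = 0 then 2 else 2 * m + 1 - x)"

text \<open>Away from \<open>0\<close>, \<open>h x + x\<close> is constant and doubling is injective
  modulo an odd number. The difference at \<open>0\<close> recurs only at \<open>2 * m\<close>, and
  the value \<open>2\<close> only at \<open>2 * m - 1\<close>; both points are outside the
  domain.\<close>

lemma partial_orthomorphism_odd_zigzag:
  assumes "2 \<le> m"
  shows "partial_orthomorphism (2 * m + 1) (odd_zigzag m) {..<2 * m - 1}"
  unfolding partial_orthomorphism_def
proof (intro conjI ballI impI)
  show "inj_on (odd_zigzag m) {..<2 * m - 1}"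
    unfolding inj_on_def odd_zigzag_def by auto
next
  fix x y assume "x \<in> {..<2 * m - 1}" "y \<in> {..<2 * m - 1}"
    and c: "[odd_zigzag m x + y = odd_zigzag m y + x] (mod 2 * m + 1)"
  then have x: "x < 2 * m - 1" and y: "y < 2 * m - 1" by auto
  define d where "d z = (if z = 0 then 2 else 2 * m + 1)" for z :: nat
  have e: "odd_zigzag m z + z = d z" if "z < 2 * m - 1" for z
    using that by (auto simp: odd_zigzag_def d_def)
  have "odd_zigzag m x + y = odd_zigzag m y + x \<or>
      odd_zigzag m x + y = odd_zigzag m y + x + (2 * m + 1) \<or>
      odd_zigzag m y + x = odd_zigzag m x + y + (2 * m + 1)"
    using c x y assms by (intro cong_nat_cases) (auto simp: odd_zigzag_def)
  then have E: "2 * y + d x = 2 * x + d y \<or> 2 * y + d x = 2 * x + d y + (2 * m + 1) \<or>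
      2 * x + d y = 2 * y + d x + (2 * m + 1)"
    using e[OF x] e[OF y] by linarith
  have parity: "2 * a \<noteq> 2 * b + 1" for a b :: nat by presburger
  show "x = y"
  proof (cases "x = 0"; cases "y = 0")
    assume "x = 0" "y \<noteq> 0"
    then show ?thesis using E x y parity[of "y + 1" m] by (simp add: d_def; linarith)
  next
    assume "x \<noteq> 0" "y = 0"
    then show ?thesis using E x y parity[of "x + 1" m] by (simp add: d_def; linarith)
  next
    assume "x \<noteq> 0" "y \<noteq> 0"
    then show ?thesis
      using E parity[of y "x + m"] parity[of x "y + m"] by (simp add: d_def; linarith)
  qed simp
qed (use assms in \<open>auto simp: odd_zigzag_def\<close>)

text \<open>The sum \<open>h x + x\<close> is constant and doubling is injective modulo odd
  \<open>n\<close>. The fixed point \<open>(n - 1) div 2\<close> rules this map out for blocked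
  cells once it is in the domain, but not for diagonal blocks.\<close>

lemma partial_orthomorphism_reflection:
  assumes "odd n"
  shows "partial_orthomorphism n (\<lambda>x. n - 1 - x) {..<n}"
  unfolding partial_orthomorphism_def
proof (intro conjI ballI impI)
  fix x y assume "x \<in> {..<n}" "y \<in> {..<n}" and c: "[n - 1 - x + y = n - 1 - y + x] (mod n)"
  then have xy: "n - 1 - x + x = n - 1" "n - 1 - y + y = n - 1" "x < n" "y < n" by auto
  have "n - 1 - x + y = n - 1 - y + x \<or> n - 1 - x + y = n - 1 - y + x + n \<or>
      n - 1 - y + x = n - 1 - x + y + n"
    using c xy by (intro cong_nat_cases) auto
  then have "2 * y = 2 * x \<or> 2 * y = 2 * x + n \<or> 2 * x = 2 * y + n"
    using xy by linarith
  then show "x = y"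
    using assms by (elim disjE) (auto dest: arg_cong[of _ _ even])
qed (auto simp: inj_on_def)

section \<open>Homogeneous squares of every degree\<close>

lemma homogeneous_triples_full:
  "homogeneous_triples n n ((\<lambda>(t, x). (t, x, (t + x) mod n)) ` ({..<n} \<times> {..<n}))"
proof -
  let ?F = "\<lambda>(t, x). (t, x, (t + x) mod n)"
  let ?T = "?F ` ({..<n} \<times> {..<n})"
  have mem: "(i, j, s) \<in> ?T \<longleftrightarrow> i < n \<and> j < n \<and> s = (i + j) mod n" for i j s by auto
  have inj: "inj_on ?F A" for A by (auto simp: inj_on_def)
  have cancel: "x = y" if "(t + x) mod n = (t + y) mod n" "x < n" "y < n" for t x y
    using that by (metis cong_add_lcancel_nat cong_def mod_less)
  have card: "card {t \<in> ?T. p t = v} = n"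
    if "card {q \<in> {..<n} \<times> {..<n}. p (?F q) = v} = n" for p v
  proof -
    have "{t \<in> ?T. p t = v} = ?F ` {q \<in> {..<n} \<times> {..<n}. p (?F q) = v}" by auto
    then show ?thesis using that by (simp add: card_image inj)
  qed
  show ?thesis
    unfolding homogeneous_triples_def mem
  proof (intro conjI allI impI)
    show "?T \<subseteq> {..<n} \<times> {..<n} \<times> {..<n}" by auto
  next
    fix i j j' s
    assume "(i < n \<and> j < n \<and> s = (i + j) mod n) \<and> (i < n \<and> j' < n \<and> s = (i + j') mod n)"
    then show "j = j'" using cancel by blast
  next
    fix i i' j s
    assume "(i < n \<and> j < n \<and> s = (i + j) mod n) \<and> (i' < n \<and> j < n \<and> s = (i' + j) mod n)"
    then show "i = i'" using cancel[of j i i'] by (simp add: add.commute)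
  next
    fix v assume v: "v < n"
    have "{q \<in> {..<n} \<times> {..<n}. fst (?F q) = v} = {v} \<times> {..<n}" using v by auto
    then show "card {t \<in> ?T. fst t = v} = n" by (intro card) simp
    have "{q \<in> {..<n} \<times> {..<n}. fst (snd (?F q)) = v} = {..<n} \<times> {v}" using v by auto
    then show "card {t \<in> ?T. fst (snd t) = v} = n" by (intro card) simp
    have "{q \<in> {..<n} \<times> {..<n}. snd (snd (?F q)) = v} =
        {q \<in> {..<n} \<times> {..<n}. (fst q + snd q) mod n = v}" by auto
    then show "card {t \<in> ?T. snd (snd t) = v} = n"
      using card_add_mod_fibre[OF v, of "{..<n}" "\<lambda>x. x"] by (intro card) simp
  qed simp
qed

text \<open>Supplies the diagonal blocks. For even \<open>n\<close> the zigzag only reaches degree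
  \<open>n - 1\<close>, so \<open>k = n\<close> comes from the addition table modulo
  \<open>n\<close>.\<close>

lemma ex_homogeneous_triples:
  assumes "k \<le> n"
  shows "\<exists>T. homogeneous_triples n k T"
proof -
  have "k \<le> 2 * (n div 2) - 1" if "k \<noteq> n" "even n"
    using assms that by auto
  then consider "k = n" | "odd n" | m where "n = 2 * m" "k \<le> 2 * m - 1"
    by (metis dvd_mult_div_cancel)
  then show ?thesis
  proof cases
    case 1
    then show ?thesis using homogeneous_triples_full by blast
  next
    case 2
    have "partial_orthomorphism n (\<lambda>x. n - 1 - x) {..<k}"
      using partial_orthomorphism_mono[OF partial_orthomorphism_reflection[OF 2]] assms by simp
    from homogeneous_triples_cyclic[OF this] show ?thesis by auto
  next
    case 3
    have "partial_orthomorphism n (even_zigzag m) {..<k}"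
      using partial_orthomorphism_mono[OF partial_orthomorphism_even_zigzag] 3 by simp
    from homogeneous_triples_cyclic[OF this] show ?thesis by auto
  qed
qed

section \<open>Prolongation\<close>

text \<open>The classical prolongation along a transversal \<open>U\<close>, except that the corner
  cell \<open>(n, n)\<close> stays blank: each symbol on \<open>U\<close> is copied to the new row
  and column, and its cell receives the new symbol \<open>n\<close>.\<close>

definition prolongation ::
  "nat \<Rightarrow> (nat \<times> nat \<times> nat) set \<Rightarrow> (nat \<times> nat \<times> nat) set \<Rightarrow> (nat \<times> nat \<times> nat) set" where
  "prolongation n T U = (T - U) \<union> (\<lambda>(i, j, s). (n, j, s)) ` U \<union>
     (\<lambda>(i, j, s). (i, n, s)) ` U \<union> (\<lambda>(i, j, s). (i, j, n)) ` U"

lemma card_transversal: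
  assumes "homogeneous_triples n 1 U"
  shows "card U = n"
proof -
  note D = homogeneous_triplesD[OF assms]
  have "U = (\<Union>v<n. {t \<in> U. fst t = v})" using D(1) by auto
  then have "card U = card (\<Union>v<n. {t \<in> U. fst t = v})" by simp
  also have "\<dots> = (\<Sum>v<n. card {t \<in> U. fst t = v})"
    by (rule card_UN_disjoint) (use D(8) in auto)
  finally show ?thesis using D(5) by simp
qed

text \<open>Every old row, column and symbol loses one triple and gains two; the new ones receive
  one triple for each of the \<open>n\<close> elements of \<open>U\<close>.\<close>

lemma homogeneous_triples_prolongation:
  assumes T: "homogeneous_triples n (n - 1) T" and U: "homogeneous_triples n 1 U"
    and "U \<subseteq> T" and "2 \<le> n"
  shows "homogeneous_triples (n + 1) n (prolongation n T U)"
proof -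
  note DT = homogeneous_triplesD[OF T] and DU = homogeneous_triplesD[OF U]
  have U1: "\<exists>!t. t \<in> U \<and> p t = v" if "card {t \<in> U. p t = v} = 1"
    for p :: "nat \<times> nat \<times> nat \<Rightarrow> nat" and v
  proof -
    from that obtain t where "{t \<in> U. p t = v} = {t}" by (rule card_1_singletonE)
    then have "t \<in> U \<and> p t = v" "\<And>u. u \<in> U \<and> p u = v \<Longrightarrow> u = t" by auto
    then show ?thesis by blast
  qed
  \<comment> \<open>On a transversal each coordinate determines the other two, so the moved triples
    cannot clash with each other.\<close>
  have r: "i = i' \<longleftrightarrow> j = j'" "i = i' \<longleftrightarrow> s = s'" if "(i, j, s) \<in> U" "(i', j', s') \<in> U" for i j s i' j' s'
  proof -
    have v: "i < n" "j < n" "s < n" using DU(1)[OF that(1)] by auto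
    show "i = i' \<longleftrightarrow> j = j'" "i = i' \<longleftrightarrow> s = s'"
      using U1[OF DU(5)[OF v(1)]] U1[OF DU(6)[OF v(2)]] U1[OF DU(7)[OF v(3)]] that
      by (metis fst_conv snd_conv)+
  qed
  let ?P = "prolongation n T U"
  have mem: "(i, j, s) \<in> ?P \<longleftrightarrow> (i, j, s) \<in> T - U \<or> (i = n \<and> (\<exists>x. (x, j, s) \<in> U)) \<or>
      (j = n \<and> (\<exists>x. (i, x, s) \<in> U)) \<or> (s = n \<and> (\<exists>x. (i, j, x) \<in> U))" for i j s
    unfolding prolongation_def by (force simp: image_iff)
  have lt: "i < n" "j < n" "s < n" if "(i, j, s) \<in> T \<or> (i, j, s) \<in> U" for i j s
    using that DT(1) DU(1) by blast+
  have n_notin: "(n, j, s) \<notin> T" "(i, n, s) \<notin> T" "(i, j, n) \<notin> T"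
      "(n, j, s) \<notin> U" "(i, n, s) \<notin> U" "(i, j, n) \<notin> U" for i j s
    using lt by blast+
  \<comment> \<open>For a projection \<open>p\<close>, the maps \<open>f\<close> and
    \<open>g\<close> are the two replacements that keep this coordinate, and \<open>h\<close> is the
    one that sets it to \<open>n\<close>.\<close>
  have card: "card {t \<in> ?P. p t = v} = n"
    if "v < n + 1" and P: "?P = (T - U) \<union> f ` U \<union> g ` U \<union> h ` U"
      and p: "\<And>t. p (f t) = p t" "\<And>t. p (g t) = p t" "\<And>t. p (h t) = n"
      and pT: "\<And>t. t \<in> T \<Longrightarrow> p t < n"
      and new: "\<And>t. t \<in> U \<Longrightarrow> f t \<notin> T \<and> g t \<notin> T \<and> f t \<noteq> g t"
      and "inj_on h U"
      and cT: "\<And>v. v < n \<Longrightarrow> card {t \<in> T. p t = v} = n - 1"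
      and cU: "\<And>v. v < n \<Longrightarrow> card {t \<in> U. p t = v} = 1"
    for p v and f g h :: "nat \<times> nat \<times> nat \<Rightarrow> nat \<times> nat \<times> nat"
  proof -
    have img: "{t \<in> e ` U. p t = v} = e ` {t \<in> U. p (e t) = v}" for e
      by blast
    have union: "{t \<in> A \<union> B. p t = v} = {t \<in> A. p t = v} \<union> {t \<in> B. p t = v}" for A B
      by blast
    have fibre: "{t \<in> ?P. p t = v} = {t \<in> T - U. p t = v} \<union>
        f ` {t \<in> U. p t = v} \<union> g ` {t \<in> U. p t = v} \<union> h ` {t \<in> U. n = v}"
      unfolding P union img p ..
    show ?thesis
    proof (cases "v = n")
      case True
      have "{t \<in> T - U. p t = v} = {}" "{t \<in> U. p t = v} = {}"
        using pT \<open>U \<subseteq> T\<close> True by blast+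
      then have "{t \<in> ?P. p t = v} = h ` U"
        by (simp only: fibre) (simp add: True)
      then show ?thesis
        using card_transversal[OF U] \<open>inj_on h U\<close> by (simp add: card_image)
    next
      case False
      then have "v < n" using that(1) by simp
      obtain t where t: "{t \<in> U. p t = v} = {t}"
        using cU[OF \<open>v < n\<close>] by (rule card_1_singletonE)
      then have "t \<in> U" by blast
      have "card ({t \<in> T. p t = v} - {t}) = n - 1 - 1"
        using t \<open>U \<subseteq> T\<close> cT[OF \<open>v < n\<close>] by (subst card_Diff_singleton) auto
      moreover have "{t \<in> T - U. p t = v} = {t \<in> T. p t = v} - {t}"
        using t by blast
      then have "{t \<in> ?P. p t = v} = insert (f t) (insert (g t) ({t \<in> T. p t = v} - {t}))"
        unfolding fibre t using False by auto
      ultimately show ?thesis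
        using new[OF \<open>t \<in> U\<close>] DT(8) \<open>2 \<le> n\<close> by simp
    qed
  qed
  let ?r = "\<lambda>(i, j, s). (n, j, s)" and ?c = "\<lambda>(i, j, s). (i, n, s)" and ?s = "\<lambda>(i, j, s). (i, j, n)"
  have inj: "inj_on ?r U" "inj_on ?c U" "inj_on ?s U"
    using DU(2-4) by (auto simp: inj_on_def)
  show ?thesis
    unfolding homogeneous_triples_def
  proof (intro conjI allI impI)
    show "?P \<subseteq> {..<n + 1} \<times> {..<n + 1} \<times> {..<n + 1}"
      using lt unfolding prolongation_def by fastforce
  next
    fix i j s s' assume "(i, j, s) \<in> ?P \<and> (i, j, s') \<in> ?P"
    then show "s = s'"
      unfolding mem by (elim conjE disjE exE; simp add: n_notin; metis DT(2) r subsetD[OF \<open>U \<subseteq> T\<close>])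
  next
    fix i j j' s assume "(i, j, s) \<in> ?P \<and> (i, j', s) \<in> ?P"
    then show "j = j'"
      unfolding mem by (elim conjE disjE exE; simp add: n_notin; metis DT(3) r subsetD[OF \<open>U \<subseteq> T\<close>])
  next
    fix i i' j s assume "(i, j, s) \<in> ?P \<and> (i', j, s) \<in> ?P"
    then show "i = i'"
      unfolding mem by (elim conjE disjE exE; simp add: n_notin; metis DT(4) r subsetD[OF \<open>U \<subseteq> T\<close>])
  next
    fix v assume v: "v < n + 1"
    show "card {t \<in> ?P. fst t = v} = n"
      by (rule card[OF v, where f = ?c and g = ?s and h = ?r, OF _ _ _ _ _ _ inj(1) DT(5) DU(5)])
        (use n_notin in \<open>auto simp: prolongation_def dest: DT(1)\<close>)
    show "card {t \<in> ?P. fst (snd t) = v} = n"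
      by (rule card[OF v, where f = ?r and g = ?s and h = ?c, OF _ _ _ _ _ _ inj(2) DT(6) DU(6)])
        (use n_notin in \<open>auto simp: prolongation_def dest: DT(1)\<close>)
    show "card {t \<in> ?P. snd (snd t) = v} = n"
      by (rule card[OF v, where f = ?r and g = ?c and h = ?s, OF _ _ _ _ _ _ inj(3) DT(7) DU(7)])
        (use n_notin in \<open>auto simp: prolongation_def dest: DT(1)\<close>)
  qed
qed

text \<open>A symbol removed from row \<open>i\<close> reappears there in the new column, and one
  removed from column \<open>j\<close> in the new row. The new symbol is seen because
  \<open>U\<close> meets row \<open>i\<close>.\<close>

lemma blocked_cell_prolongation:
  assumes T: "homogeneous_triples n k T" and U: "homogeneous_triples n 1 U"
    and "U \<subseteq> T" and B: "blocked_cell n i j T"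
  shows "blocked_cell (n + 1) i j (prolongation n T U)"
proof -
  note DU = homogeneous_triplesD[OF U]
  have mem: "(i, j, s) \<in> prolongation n T U \<longleftrightarrow> (i, j, s) \<in> T - U \<or> (i = n \<and> (\<exists>x. (x, j, s) \<in> U)) \<or>
      (j = n \<and> (\<exists>x. (i, x, s) \<in> U)) \<or> (s = n \<and> (\<exists>x. (i, j, x) \<in> U))" for i j s
    unfolding prolongation_def by (force simp: image_iff)
  have ij: "i < n" "j < n" and empty: "\<And>s. (i, j, s) \<notin> T"
    and B': "\<And>s. s < n \<Longrightarrow> (\<exists>j'. (i, j', s) \<in> T) \<or> (\<exists>i'. (i', j, s) \<in> T)"
    using B unfolding blocked_cell_def by auto
  have "(i, j, s) \<notin> prolongation n T U" for s
    unfolding mem using ij empty \<open>U \<subseteq> T\<close> by auto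
  moreover have "(\<exists>j'. (i, j', s) \<in> prolongation n T U) \<or> (\<exists>i'. (i', j, s) \<in> prolongation n T U)"
    if "s < n + 1" for s
  proof (cases "s = n")
    case True
    have "{t \<in> U. fst t = i} \<noteq> {}" using DU(5)[OF ij(1)] by force
    then obtain y z where "(i, y, z) \<in> U" by auto
    then show ?thesis unfolding mem True by blast
  next
    case False
    then show ?thesis using B'[of s] that unfolding mem by (metis DiffI less_Suc_eq Suc_eq_plus1)
  qed
  ultimately show ?thesis using ij unfolding blocked_cell_def by auto
qed

section \<open>Blocked squares of large degree\<close>

text \<open>The points \<open>x < m\<close> cover the lower half of the residues and their images
  the upper half. A fixed point would need \<open>2 * x = 2 * m - 1\<close>, or
  \<open>x = m - 1\<close> in the upper half.\<close>

lemma blocked_cell_even_zigzag: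
  assumes "1 \<le> m" "m \<le> k" "k < 2 * m"
  shows "blocked_cell (2 * m) 0 0 (cyclic_triples (2 * m) (even_zigzag m) {..<k})"
proof (rule blocked_cell_cyclic)
  show "partial_orthomorphism (2 * m) (even_zigzag m) {..<k}"
    using partial_orthomorphism_mono[OF partial_orthomorphism_even_zigzag] assms by simp
  show "{..<2 * m} \<subseteq> {..<k} \<union> even_zigzag m ` {..<k}"
  proof
    fix y assume "y \<in> {..<2 * m}"
    then show "y \<in> {..<k} \<union> even_zigzag m ` {..<k}"
      using assms by (cases "y < m") (auto simp: even_zigzag_def intro!: image_eqI[of _ _ "2 * m - 1 - y"])
  qed
qed (use assms in \<open>auto simp: even_zigzag_def split: if_splits\<close>)

lemma ex_blocked_even:
  assumes "m \<le> k" "k < 2 * m"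
  shows "\<exists>T. homogeneous_triples (2 * m) k T \<and> blocked_cell (2 * m) 0 0 T"
proof -
  have "partial_orthomorphism (2 * m) (even_zigzag m) {..<k}"
    using partial_orthomorphism_mono[OF partial_orthomorphism_even_zigzag] assms by simp
  from homogeneous_triples_cyclic[OF this] show ?thesis
    using blocked_cell_even_zigzag[of m k] assms by auto
qed

lemma ex_blocked_odd:
  assumes "m < k" "k < 2 * m"
  shows "\<exists>T. homogeneous_triples (2 * m + 1) k T \<and> blocked_cell (2 * m + 1) 0 0 T"
proof -
  have po: "partial_orthomorphism (2 * m + 1) (odd_zigzag m) {..<k}"
    using partial_orthomorphism_mono[OF partial_orthomorphism_odd_zigzag] assms by simp
  have "blocked_cell (2 * m + 1) 0 0 (cyclic_triples (2 * m + 1) (odd_zigzag m) {..<k})"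
  proof (rule blocked_cell_cyclic[OF po])
    show "{..<2 * m + 1} \<subseteq> {..<k} \<union> odd_zigzag m ` {..<k}"
    proof
      fix y assume "y \<in> {..<2 * m + 1}"
      then show "y \<in> {..<k} \<union> odd_zigzag m ` {..<k}"
        using assms by (cases "y \<le> m") (auto simp: odd_zigzag_def intro!: image_eqI[of _ _ "2 * m + 1 - y"])
    qed
    show "odd_zigzag m x \<noteq> x" for x
      unfolding odd_zigzag_def by presburger
  qed (use assms in auto)
  then show ?thesis using homogeneous_triples_cyclic[OF po] by auto
qed

text \<open>The odd zigzag stops at degree \<open>2 * m - 1\<close>. Degree \<open>2 * m\<close>
  comes from the even square of order \<open>2 * m\<close> and degree \<open>2 * m - 1\<close>, with
  the orbit of \<open>x = 0\<close> as transversal.\<close>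

lemma ex_blocked_odd_max:
  assumes "1 \<le> m"
  shows "\<exists>T. homogeneous_triples (2 * m + 1) (2 * m) T \<and> blocked_cell (2 * m + 1) 0 0 T"
proof -
  let ?C = "cyclic_triples (2 * m) (even_zigzag m)"
  note po = partial_orthomorphism_even_zigzag[of m]
  have T: "homogeneous_triples (2 * m) (2 * m - 1) (?C {..<2 * m - 1})"
    using homogeneous_triples_cyclic[OF po] by simp
  have po0: "partial_orthomorphism (2 * m) (even_zigzag m) {0}"
    using partial_orthomorphism_mono[OF po] assms by simp
  have U: "homogeneous_triples (2 * m) 1 (?C {0})"
    using homogeneous_triples_cyclic[OF po0] by simp
  have "{0} \<subseteq> {..<2 * m - 1}"
    using assms by auto
  then have sub: "?C {0} \<subseteq> ?C {..<2 * m - 1}"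
    unfolding cyclic_triples_def by (intro image_mono Sigma_mono) auto
  have B: "blocked_cell (2 * m) 0 0 (?C {..<2 * m - 1})"
    using blocked_cell_even_zigzag[of m "2 * m - 1"] assms by simp
  show ?thesis
    using homogeneous_triples_prolongation[OF T U sub] blocked_cell_prolongation[OF T U sub B] assms by auto
qed

section \<open>Block diagonal squares and the final case split\<close>

lemma ex_block_diagonal:
  assumes "1 < k" "n < 4 * k" "k \<le> n div 2"
  shows "\<exists>T. homogeneous_triples n k T \<and> \<not> completable n (square_of_triples T)"
proof -
  define a where "a = n div 2"
  have a: "a \<le> n" "k \<le> a" "k \<le> n - a" "a + (n - a) = n"
    using assms by (auto simp: a_def)
  obtain T U where T: "homogeneous_triples a k T" and U: "homogeneous_triples (n - a) k U"
    using ex_homogeneous_triples a by blast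
  have S: "homogeneous_triples n k (direct_sum a T U)"
    using homogeneous_triples_direct_sum[OF T U] a by simp
  \<comment> \<open>For \<open>n = 2 * a\<close> this is \<open>a < 2 * k\<close> times
    \<open>a\<close>. For \<open>n = 2 * a + 1\<close> the term \<open>2 * a - n = -1\<close> costs
    \<open>a + 1\<close>; the bound \<open>a + 1 \<le> 2 * k\<close> pays for \<open>a\<close> of it
    and \<open>1 < k\<close> for the rest, strictly.\<close>
  have "int a * int a < int n * int k + (int n - int a) * (2 * int a - int n)"
  proof (cases "even n")
    case True
    then have n: "int n = 2 * int a" and "int a < 2 * int k"
      using assms by (auto simp: a_def)
    then have "int a * int a < int a * (2 * int k)"
      using a assms by (intro mult_strict_left_mono) auto
    then show ?thesis by (simp add: n)
  next
    case False
    then have n: "int n = 2 * int a + 1" and "int a + 1 \<le> 2 * int k"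
      using assms unfolding a_def by presburger+
    then have "int a * (int a + 1) \<le> int a * (2 * int k)"
      by (intro mult_left_mono) auto
    then show ?thesis using assms(1) by (simp add: n algebra_simps)
  qed
  moreover have "(i < a \<longleftrightarrow> j < a) \<and> (i < a \<longleftrightarrow> s < a)" if "(i, j, s) \<in> direct_sum a T U" for i j s
    using that homogeneous_triplesD(1)[OF T] unfolding direct_sum_def by force
  ultimately show ?thesis
    using not_completable_if_block_diagonal[OF S \<open>a \<le> n\<close>] S by blast
qed

theorem theorem5p6:
  fixes n k :: nat
  assumes "1 < k" and "k < n" and "n < 4 * k"
  shows "\<exists>P. homogeneous_pls n k P \<and> \<not> completable n P"
proof -
  have "\<exists>T. homogeneous_triples n k T \<and> \<not> completable n (square_of_triples T)"
  proof (cases "k \<le> n div 2")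
    case True
    then show ?thesis using ex_block_diagonal assms by blast
  next
    case False
    define m where "m = n div 2"
    have "n = 2 * m \<or> n = 2 * m + 1" unfolding m_def by presburger
    with False assms consider "n = 2 * m" "m \<le> k" "k < 2 * m"
      | "n = 2 * m + 1" "m < k" "k < 2 * m" | "n = 2 * m + 1" "k = 2 * m" "1 \<le> m"
      unfolding m_def[symmetric] by linarith
    then have "\<exists>T. homogeneous_triples n k T \<and> blocked_cell n 0 0 T"
      using ex_blocked_even ex_blocked_odd ex_blocked_odd_max by cases auto
    then show ?thesis using not_completable_if_blocked_cell by blast
  qed
  then show ?thesis using homogeneous_pls_square_of_triples by blast
qed

end
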